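(* Let $d\ge 2$ be an integer, let $\eta_d=\tan\frac{\pi}{4(d-1)}$, let $0\le\eta<\eta_d$ be real and let $$\tau=(1-\eta)\sin\left(\frac{\pi}{4(d-1)}-\arctan\eta\right)>0.$$ Let $n$ be a positive integer and let $Z=(z_{i_1\ldots i_d})$ be a $d$-dimensional $n\times\cdots\times n$ tensor of complex numbers such that $$\left|1-\Re z_{i_1\ldots i_d}\right|\le\eta\quad\text{and}\quad\left|\Im z_{i_1\ldots i_d}\right|\le\tau\quad\text{for all }1\le i_1,\dots,i_d\le n.$$ Then $\operatorname{PER}Z\ne 0$.
   Context: The permanent of a $d$-dimensional $n\times\cdots\times n$ array (tensor) $Z=(z_{i_1\ldots i_d})$ of $n^d$ real or complex numbers is $$\operatorname{PER}Z=\sum_{\sigma_2,\dots,\sigma_d\in S_n}\ \prod_{i=1}^n z_{i\,\sigma_2(i)\ldots\sigma_d(i)},$$ where $S_n$ is the symmetric group of permutations of $\{1,\dots,n\}$. $\Re z$ and $\Im z$ denote the real and imaginary parts of $z$; $\arctan$ takes values in $(-\pi/2,\pi/2)$. *)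

theory Defs
  imports Complex_Main "HOL-Combinatorics.Permutations" "HOL-Library.FuncSet"
begin

text \<open>
  A \<open>d\<close>-dimensional \<open>n \<times> \<dots> \<times> n\<close> tensor is represented by a function on index lists
  \<open>[i\<^sub>1, \<dots>, i\<^sub>d]\<close>; only its values on \<open>tensor_indices d n\<close> are meaningful.
\<close>

definition tensor_indices :: "nat \<Rightarrow> nat \<Rightarrow> nat list set" where
  "tensor_indices d n = {is. length is = d \<and> set is \<subseteq> {1..n}}"

text \<open>
  A tuple \<open>(\<sigma>\<^sub>2, \<dots>, \<sigma>\<^sub>d)\<close> of permutations is a function \<open>\<sigma>\<close> on \<open>{2..d}\<close>. It is extensional
  (\<open>\<Pi>\<^sub>E\<close>), so each tuple is counted exactly once.
\<close>

definition PER :: "nat \<Rightarrow> nat \<Rightarrow> (nat list \<Rightarrow> 'a::comm_ring_1) \<Rightarrow> 'a" where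
  "PER d n Z =
     (\<Sum>\<sigma> \<in> ({2..d} \<rightarrow>\<^sub>E {p. p permutes {1..n}}).
        \<Prod>i = 1..n. Z (i # map (\<lambda>k. \<sigma> k i) [2..<Suc d]))"

end

theory Submission
  imports Defs
begin

text \<open>
  The proof follows an induction on \<open>n\<close> that controls angles between permanents, regarded as vectors
  in the plane. Put \<open>\<alpha> = \<pi> / (2 (d - 1))\<close>. The claim carried through the induction is that
  permanents of size \<open>n\<close> do not vanish, and that exchanging one slice of the tensor for another
  turns the permanent by an angle of at most \<open>\<alpha>\<close>.

  Expand two permanents that differ by one slice along the slices being exchanged: they become
  \<open>\<Sum>\<^sub>e a\<^sub>e u\<^sub>e\<close> and \<open>\<Sum>\<^sub>e b\<^sub>e u\<^sub>e\<close> with the same minors \<open>u\<^sub>e\<close>. Two of these minors differ by at most one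
  slice exchange in each of the \<open>d - 1\<close> other directions, so by induction they are nonzero and enclose an
  angle of at most \<open>(d - 1) \<alpha> = \<pi> / 2\<close>. After a rotation all minors lie in the closed first
  quadrant, where nothing cancels. The real parts of the coefficients change each coordinate of
  \<open>\<Sum>\<^sub>e u\<^sub>e\<close> by a factor in \<open>[1 - \<eta>, 1 + \<eta>]\<close>, and two vectors obtained in this way enclose an angle
  of at most \<open>2 arctan \<eta>\<close>. The imaginary parts add a vector at most \<open>\<tau> / (1 - \<eta>)\<close> times as long,
  which is \<open>sin \<beta>\<close> for \<open>\<beta> = \<pi> / (4 (d - 1)) - arctan \<eta>\<close>, and turn each of the two sums by at
  most \<open>\<beta>\<close>. The total is \<open>2 arctan \<eta> + 2 \<beta> = \<alpha>\<close>, which closes the induction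
  (\<open>angle_le_of_acute_sums\<close>, \<open>matching_sum_exchange\<close>).

  The induction needs minors in every direction, whereas the definition of the permanent singles
  out the first one. It is therefore run on a symmetric form: the sum over all perfect
  matchings of \<open>d\<close> index sets, of which the permanent is the case where every set is \<open>{1..n}\<close>
  (\<open>PER_eq_matching_sum\<close>). Minors are then obtained by shrinking the index sets, and exchanging a
  slice means exchanging one element of one index set, with the same tensor throughout.
\<close>

section \<open>Bounds on the angle between complex numbers\<close>

text \<open>
  Stating the bound through a rotation, not through the principal argument, makes
  the triangle inequality a matter of adding the rotation angles, with no reduction modulo \<open>2 \<pi>\<close>.
  The number \<open>0\<close> makes no angle with anything, so each bound also records that both
  numbers are nonzero.
\<close>

definition angle_le :: "real \<Rightarrow> complex \<Rightarrow> complex \<Rightarrow> bool" where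
  "angle_le \<alpha> u v \<longleftrightarrow> u \<noteq> 0 \<and> (\<exists>r>0. \<exists>\<theta>. \<bar>\<theta>\<bar> \<le> \<alpha> \<and> v = rcis r \<theta> * u)"

lemma angle_le_refl: "u \<noteq> 0 \<Longrightarrow> 0 \<le> \<alpha> \<Longrightarrow> angle_le \<alpha> u u"
  unfolding angle_le_def by (intro conjI exI[of _ 1] exI[of _ 0]) (auto simp: rcis_def)

lemma angle_le_nonzero: "angle_le \<alpha> u v \<Longrightarrow> u \<noteq> 0 \<and> v \<noteq> 0"
  unfolding angle_le_def by (auto simp: rcis_def)

lemma angle_le_sym:
  assumes "angle_le \<alpha> u v"
  shows "angle_le \<alpha> v u"
proof -
  obtain r \<theta> where r: "r > 0" "\<bar>\<theta>\<bar> \<le> \<alpha>" "v = rcis r \<theta> * u"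
    using assms unfolding angle_le_def by blast
  have "u = rcis (inverse r) (- \<theta>) * v"
    using r by (simp add: mult.assoc[symmetric] rcis_mult)
  then show ?thesis
    using r angle_le_nonzero[OF assms] unfolding angle_le_def
    by (intro conjI exI[of _ "inverse r"] exI[of _ "- \<theta>"]) auto
qed

lemma angle_le_trans:
  assumes "angle_le \<alpha> u v" "angle_le \<beta> v w"
  shows "angle_le (\<alpha> + \<beta>) u w"
proof -
  obtain r \<theta> where r: "r > 0" "\<bar>\<theta>\<bar> \<le> \<alpha>" "v = rcis r \<theta> * u"
    using assms(1) unfolding angle_le_def by blast
  obtain s \<phi> where s: "s > 0" "\<bar>\<phi>\<bar> \<le> \<beta>" "w = rcis s \<phi> * v"
    using assms(2) unfolding angle_le_def by blast
  have "w = rcis (s * r) (\<phi> + \<theta>) * u"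
    using r s by (simp add: mult.assoc[symmetric] rcis_mult)
  moreover have "\<bar>\<phi> + \<theta>\<bar> \<le> \<alpha> + \<beta>" using r s by linarith
  ultimately show ?thesis
    using r s angle_le_nonzero[OF assms(1)] unfolding angle_le_def
    by (intro conjI exI[of _ "s * r"] exI[of _ "\<phi> + \<theta>"]) auto
qed

lemma angle_le_mult_cancel:
  assumes "c \<noteq> 0" "angle_le \<alpha> (c * u) (c * v)"
  shows "angle_le \<alpha> u v"
proof -
  obtain r \<theta> where r: "r > 0" "\<bar>\<theta>\<bar> \<le> \<alpha>" "c * v = rcis r \<theta> * (c * u)"
    using assms unfolding angle_le_def by blast
  have "v = rcis r \<theta> * u" using r(3) assms(1) by (simp add: mult.left_commute)
  then show ?thesis using r angle_le_nonzero[OF assms(2)] unfolding angle_le_def by auto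
qed

text \<open>
  On \<open>[0, \<pi>]\<close> the cosine is decreasing, so an angle bound can be read off from the inner product
  \<open>Re (cnj u * v)\<close>. Both basic estimates, for small perturbations and for boxes, use this criterion.
\<close>

lemma angle_leI_cos:
  assumes "0 \<le> \<alpha>" "\<alpha> \<le> pi" "u \<noteq> 0" "v \<noteq> 0"
    and "cos \<alpha> * (cmod u * cmod v) \<le> Re (cnj u * v)"
  shows "angle_le \<alpha> u v"
proof -
  define w where "w = v / u"
  have w0: "w \<noteq> 0" and v: "v = w * u" using assms by (auto simp: w_def)
  have "cnj u * v = of_real ((cmod u)\<^sup>2) * w"
    unfolding v complex_norm_square by (simp add: mult_ac)
  then have "Re (cnj u * v) = (cmod u)\<^sup>2 * Re w" by simp
  moreover have "cos \<alpha> * (cmod u * cmod v) = (cmod u)\<^sup>2 * (cos \<alpha> * cmod w)"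
    by (simp add: v norm_mult power2_eq_square)
  ultimately have le: "cos \<alpha> * cmod w \<le> Re w"
    using assms(3,5) by (metis mult_le_cancel_left_pos zero_less_norm_iff zero_less_power)
  have "Re w = cmod w * cos (Arg w)"
    using arg_cong[OF rcis_cmod_Arg[of w], of Re] by simp
  then have "cos \<alpha> \<le> cos \<bar>Arg w\<bar>" using le w0 by (simp add: mult.commute)
  moreover have "\<bar>Arg w\<bar> \<le> pi" using Arg_bounded[of w] by linarith
  ultimately have "\<bar>Arg w\<bar> \<le> \<alpha>" using assms(1,2) by (subst (asm) cos_mono_le_eq) auto
  then show ?thesis
    unfolding angle_le_def using assms(3) w0 v rcis_cmod_Arg[of w]
    by (intro conjI exI[of _ "cmod w"] exI[of _ "Arg w"]) auto
qed

lemma angle_leD_right_angle: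
  assumes "angle_le (pi / 2) u v"
  shows "0 \<le> Re (cnj u * v)"
proof -
  obtain r \<theta> where r: "r > 0" "\<bar>\<theta>\<bar> \<le> pi / 2" "v = rcis r \<theta> * u"
    using assms unfolding angle_le_def by blast
  have "cnj u * v = of_real ((cmod u)\<^sup>2) * rcis r \<theta>"
    unfolding r complex_norm_square by (simp add: mult_ac)
  then have "Re (cnj u * v) = (cmod u)\<^sup>2 * (r * cos \<theta>)" by simp
  moreover have "0 \<le> cos \<theta>" using r(2) by (intro cos_ge_zero) auto
  ultimately show ?thesis using r(1) by simp
qed

text \<open>
  The disc of radius \<open>\<bar>u\<bar> sin \<beta>\<close> around \<open>u\<close> is seen from the origin under the half angle \<open>\<beta>\<close>.
\<close>

lemma angle_le_small_perturbation:
  assumes "0 \<le> \<beta>" "\<beta> < pi / 2" "u \<noteq> 0" "cmod e \<le> sin \<beta> * cmod u"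
  shows "angle_le \<beta> u (u + e)"
proof -
  have sc: "(sin \<beta>)\<^sup>2 = 1 - (cos \<beta>)\<^sup>2" by (simp add: sin_squared_eq)
  have cpos: "0 < cos \<beta>" using assms by (intro cos_gt_zero_pi) auto
  then have "sin \<beta> < 1" using sc assms
    by (smt (verit) one_power2 power_mono zero_less_power)
  then have "cmod e < cmod u" using assms(3,4)
    by (smt (verit) mult_less_cancel_right2 zero_less_norm_iff)
  then have ne: "u + e \<noteq> 0" by (metis add_eq_0_iff less_irrefl norm_minus_cancel)
  have "(cmod e)\<^sup>2 \<le> (sin \<beta> * cmod u)\<^sup>2" using assms(4) by (intro power_mono) auto
  also have "\<dots> = (cmod u)\<^sup>2 - (cos \<beta> * cmod u)\<^sup>2"
    by (simp add: power_mult_distrib sc left_diff_distrib)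
  finally have 1: "(cmod e)\<^sup>2 \<le> (cmod u)\<^sup>2 - (cos \<beta> * cmod u)\<^sup>2" .
  have "(cmod e)\<^sup>2 = (cmod (u + e))\<^sup>2 - 2 * Re (cnj u * (u + e)) + (cmod u)\<^sup>2"
    unfolding cmod_power2 by (simp add: power2_eq_square algebra_simps)
  then have "(cmod (u + e))\<^sup>2 + (cos \<beta> * cmod u)\<^sup>2 \<le> 2 * Re (cnj u * (u + e))"
    using 1 by linarith
  \<comment> \<open>The arithmetic-geometric mean inequality is attained when \<open>u + e\<close> is the point of tangency.\<close>
  moreover have "2 * (cmod (u + e) * (cos \<beta> * cmod u)) \<le> (cmod (u + e))\<^sup>2 + (cos \<beta> * cmod u)\<^sup>2"
    using sum_squares_bound[of "cmod (u + e)" "cos \<beta> * cmod u"] by (simp add: mult.assoc)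
  ultimately have "cos \<beta> * (cmod u * cmod (u + e)) \<le> Re (cnj u * (u + e))"
    unfolding mult.left_commute[of "cos \<beta>"] mult.commute[of "cmod u" "cmod (u + e)"]
    by (simp only: mult_ac)
  with assms ne show ?thesis by (intro angle_leI_cos) auto
qed

text \<open>
  For vectors in the first quadrant, \<open>P\<close> and \<open>Q\<close> are the two terms of their cross product and \<open>D\<close> is
  their inner product, so the conclusion bounds the tangent of their angle by
  \<open>2 \<eta> / (1 - \<eta>\<^sup>2) = tan (2 arctan \<eta>)\<close>. With \<open>p = sqrt P\<close> and \<open>q = sqrt Q\<close>, the ratio \<open>p / q\<close> is at
  most \<open>(1 + \<eta>) / (1 - \<eta>)\<close>, and \<open>p / q - q / p\<close> is increasing in this ratio.
\<close>

lemma cross_term_bound: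
  fixes P Q D \<eta> :: real
  assumes "0 \<le> P" "0 \<le> Q" "0 \<le> D" "0 \<le> \<eta>" "\<eta> < 1"
    and PQ: "(1 - \<eta>)\<^sup>2 * P \<le> (1 + \<eta>)\<^sup>2 * Q" and D: "4 * (P * Q) \<le> D\<^sup>2"
  shows "(1 - \<eta>\<^sup>2) * (P - Q) \<le> 2 * \<eta> * D"
proof -
  define p q where "p = sqrt P" and "q = sqrt Q"
  have pq: "P = p\<^sup>2" "Q = q\<^sup>2" "0 \<le> p" "0 \<le> q" using assms by (auto simp: p_def q_def)
  have "((1 - \<eta>) * p)\<^sup>2 \<le> ((1 + \<eta>) * q)\<^sup>2" using PQ by (simp add: pq(1,2) power_mult_distrib)
  then have 1: "(1 - \<eta>) * p \<le> (1 + \<eta>) * q" 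
    by (rule power2_le_imp_le) (use assms(4) pq(4) in simp)
  have "(2 * (p * q))\<^sup>2 \<le> D\<^sup>2" using D by (simp add: pq(1,2) power_mult_distrib)
  then have 2: "2 * (p * q) \<le> D" by (rule power2_le_imp_le) (rule assms(3))
  have "(1 - \<eta>\<^sup>2) * (P - Q) - 4 * \<eta> * (p * q)
      = ((1 - \<eta>) * p - (1 + \<eta>) * q) * ((1 + \<eta>) * p + (1 - \<eta>) * q)"
    by (simp add: pq(1,2) power2_eq_square algebra_simps)
  also have "\<dots> \<le> 0" using 1 assms(4,5) pq(3,4) by (intro mult_nonpos_nonneg) simp_all
  finally show ?thesis using mult_left_mono[OF 2, of "2 * \<eta>"] assms(4) by (simp add: mult_ac)
qed

text \<open>
  The slopes of \<open>v\<close> and \<open>w\<close> differ by a factor of at most \<open>((1 + \<eta>) / (1 - \<eta>))\<^sup>2\<close>. Comparing both with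
  \<open>Complex X Y\<close> and adding the two angles would give only \<open>2 arcsin \<eta>\<close>;
  the sharper bound needs the direct comparison.
\<close>

lemma angle_le_box:
  fixes X Y \<eta> :: real and v w :: complex
  assumes \<eta>: "0 \<le> \<eta>" "\<eta> < 1" and XY: "0 \<le> X" "0 \<le> Y" "X \<noteq> 0 \<or> Y \<noteq> 0"
    and v: "(1 - \<eta>) * X \<le> Re v" "Re v \<le> (1 + \<eta>) * X" "(1 - \<eta>) * Y \<le> Im v" "Im v \<le> (1 + \<eta>) * Y"
    and w: "(1 - \<eta>) * X \<le> Re w" "Re w \<le> (1 + \<eta>) * X" "(1 - \<eta>) * Y \<le> Im w" "Im w \<le> (1 + \<eta>) * Y"
  shows "angle_le (2 * arctan \<eta>) v w"
proof -
  have XYm: "0 \<le> (1 - \<eta>) * X" "0 \<le> (1 - \<eta>) * Y" using \<eta> XY by auto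
  then have nn: "0 \<le> Re v" "0 \<le> Im v" "0 \<le> Re w" "0 \<le> Im w" using v w by linarith+
  have "0 < (1 - \<eta>) * X \<or> 0 < (1 - \<eta>) * Y" using \<eta> XY by auto
  then have ne: "v \<noteq> 0" "w \<noteq> 0" using v w by auto
  define D where "D = Re (cnj v * w)"
  have Deq: "D = Re v * Re w + Im v * Im w" by (simp add: D_def)
  have D0: "0 \<le> D" using nn by (simp add: Deq)
  have D4: "4 * ((Re v * Im w) * (Re w * Im v)) \<le> D\<^sup>2"
  proof -
    have "D\<^sup>2 - 4 * ((Re v * Im w) * (Re w * Im v)) = (Re v * Re w - Im v * Im w)\<^sup>2"
      by (simp add: Deq power2_eq_square algebra_simps)
    then show ?thesis using zero_le_power2[of "Re v * Re w - Im v * Im w"] by linarith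
  qed
  have cross: "(1 - \<eta>)\<^sup>2 * (Re a * Im b) \<le> (1 + \<eta>)\<^sup>2 * (Re b * Im a)"
    if "Re a \<le> (1 + \<eta>) * X" "Im b \<le> (1 + \<eta>) * Y" "(1 - \<eta>) * X \<le> Re b" "(1 - \<eta>) * Y \<le> Im a"
      "0 \<le> Re a" "0 \<le> Im b" "0 \<le> Re b" "0 \<le> Im a" for a b
  proof -
    have "Re a * Im b \<le> ((1 + \<eta>) * X) * ((1 + \<eta>) * Y)"
      using that \<eta> XY by (intro mult_mono) auto
    then have "(1 - \<eta>)\<^sup>2 * (Re a * Im b) \<le> (1 - \<eta>)\<^sup>2 * (((1 + \<eta>) * X) * ((1 + \<eta>) * Y))"
      by (intro mult_left_mono) auto
    also have "\<dots> = (1 + \<eta>)\<^sup>2 * (((1 - \<eta>) * X) * ((1 - \<eta>) * Y))"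
      by (simp add: power2_eq_square mult_ac)
    also have "\<dots> \<le> (1 + \<eta>)\<^sup>2 * (Re b * Im a)"
      using that XYm by (intro mult_left_mono mult_mono) auto
    finally show ?thesis .
  qed
  have b1: "(1 - \<eta>\<^sup>2) * (Re v * Im w - Re w * Im v) \<le> 2 * \<eta> * D"
    using cross[of v w] v w nn \<eta> D0 D4 by (intro cross_term_bound) auto
  have b2: "(1 - \<eta>\<^sup>2) * (Re w * Im v - Re v * Im w) \<le> 2 * \<eta> * D"
    using cross[of w v] v w nn \<eta> D0 D4 by (intro cross_term_bound) (auto simp: mult_ac)
  \<comment> \<open>Here \<open>C\<close> is the cross product of \<open>v\<close> and \<open>w\<close>, and \<open>C / D\<close> is the tangent of the angle from \<open>v\<close> to \<open>w\<close>.\<close>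
  define C where "C = Re v * Im w - Re w * Im v"
  have absC: "\<bar>(1 - \<eta>\<^sup>2) * C\<bar> \<le> 2 * \<eta> * D"
    using b1 b2 unfolding C_def abs_le_iff by (simp add: algebra_simps)
  have CD: "(cmod v * cmod w)\<^sup>2 = C\<^sup>2 + D\<^sup>2"
    unfolding power_mult_distrib cmod_power2 C_def Deq by (simp add: power2_eq_square algebra_simps)
  have "((1 - \<eta>\<^sup>2) * (cmod v * cmod w))\<^sup>2 = ((1 - \<eta>\<^sup>2) * C)\<^sup>2 + ((1 - \<eta>\<^sup>2) * D)\<^sup>2"
    unfolding power_mult_distrib[of "1 - \<eta>\<^sup>2"] CD by (rule distrib_left)
  also have "\<dots> \<le> (2 * \<eta> * D)\<^sup>2 + ((1 - \<eta>\<^sup>2) * D)\<^sup>2"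
    using absC power_mono[OF absC, of 2] by simp
  also have "\<dots> = ((1 + \<eta>\<^sup>2) * D)\<^sup>2" by (simp add: power2_eq_square algebra_simps)
  finally have "(1 - \<eta>\<^sup>2) * (cmod v * cmod w) \<le> (1 + \<eta>\<^sup>2) * D"
    by (rule power2_le_imp_le) (use D0 in auto)
  then have "(1 - \<eta>\<^sup>2) / (1 + \<eta>\<^sup>2) * (cmod v * cmod w) \<le> D"
    by (simp add: pos_divide_le_eq mult.commute add_pos_nonneg)
  moreover have "cos (2 * arctan \<eta>) = (1 - \<eta>\<^sup>2) / (1 + \<eta>\<^sup>2)"
    by (simp add: cos_double cos_arctan sin_arctan power_divide diff_divide_distrib)
  moreover have "2 * arctan \<eta> \<le> pi" using arctan_ubound[of \<eta>] by linarith
  ultimately show ?thesis using ne \<eta> unfolding D_def by (intro angle_leI_cos) auto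
qed

section \<open>Linear combinations with coefficients near 1\<close>

text \<open>
  Arguments relative to one fixed member lie in \<open>[-\<pi>/2, \<pi>/2]\<close>, hence there is a member \<open>u m\<close> of least
  argument. Rotating it onto the positive real axis brings every other member into the upper
  half plane, and acuteness with respect to \<open>u m\<close> puts it in the right half plane as well.
\<close>

lemma acute_family_in_rotated_quadrant:
  assumes "finite J" "J \<noteq> {}" and ne: "\<And>j. j \<in> J \<Longrightarrow> u j \<noteq> 0"
    and acute: "\<And>i j. i \<in> J \<Longrightarrow> j \<in> J \<Longrightarrow> 0 \<le> Re (cnj (u i) * u j)"
  obtains c where "c \<noteq> 0" "\<And>j. j \<in> J \<Longrightarrow> 0 \<le> Re (c * u j) \<and> 0 \<le> Im (c * u j)"
proof -
  obtain j0 where j0: "j0 \<in> J" using assms by blast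
  define t where "t j = Arg (cnj (u j0) * u j)" for j
  have rc: "cnj (u j0) * u j = rcis (cmod (cnj (u j0) * u j)) (t j)" for j
    unfolding t_def by (rule rcis_cmod_Arg[symmetric])
  define m where "m = arg_min_on t J"
  have mJ: "m \<in> J" and mmin: "\<And>j. j \<in> J \<Longrightarrow> t m \<le> t j"
    unfolding m_def using assms arg_min_if_finite(1)[of J t] arg_min_least[of J _ t] by auto
  define c where "c = cnj (u m)"
  have tb: "\<bar>t j\<bar> \<le> pi / 2" if "j \<in> J" for j
  proof -
    define z where "z = cnj (u j0) * u j"
    have z0: "z \<noteq> 0" using ne j0 that by (simp add: z_def)
    have "0 \<le> Re z" unfolding z_def using acute j0 that by blast
    have "0 \<le> cmod z * cos (t j)"
      using \<open>0 \<le> Re z\<close> arg_cong[OF rc[of j], of Re] unfolding z_def by simp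
    then have "0 \<le> cos \<bar>t j\<bar>" using z0 by (simp add: zero_le_mult_iff)
    moreover have "\<bar>t j\<bar> \<le> pi" using Arg_bounded[of z] unfolding t_def z_def by linarith
    ultimately show ?thesis
      using cos_mono_le_eq[of "pi/2" "\<bar>t j\<bar>"] by simp
  qed
  have "0 \<le> Re (c * u j) \<and> 0 \<le> Im (c * u j)" if jJ: "j \<in> J" for j
  proof -
    have "t m - t j \<le> 0" "t j - t m \<le> pi" using mmin[OF jJ] tb[OF jJ] tb[OF mJ] by linarith+
    define A B where "A = cmod (cnj (u j0) * u m)" and "B = cmod (cnj (u j0) * u j)"
    have "of_real ((cmod (u j0))\<^sup>2) * (c * u j) = cnj (cnj (u j0) * u m) * (cnj (u j0) * u j)"
      unfolding c_def complex_norm_square by (simp add: mult_ac)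
    also have "\<dots> = cnj (rcis A (t m)) * rcis B (t j)"
      unfolding A_def B_def rc[symmetric] ..
    also have "cnj (rcis A (t m)) = rcis A (- t m)" by (simp add: rcis_def cis_cnj)
    also have "rcis A (- t m) * rcis B (t j) = rcis (A * B) (t j - t m)"
      unfolding rcis_mult by simp
    finally have eq: "of_real ((cmod (u j0))\<^sup>2) * (c * u j) = rcis (A * B) (t j - t m)" .
    have "0 \<le> sin (t j - t m)"
      using \<open>t m - t j \<le> 0\<close> \<open>t j - t m \<le> pi\<close> by (intro sin_ge_zero) auto
    then have "0 \<le> (cmod (u j0))\<^sup>2 * Im (c * u j)"
      using arg_cong[OF eq, of Im] by (simp add: A_def B_def)
    then have "0 \<le> Im (c * u j)" using ne[OF j0] by (simp add: zero_le_mult_iff)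
    then show ?thesis using acute[OF mJ jJ] unfolding c_def by simp
  qed
  moreover have "c \<noteq> 0" using ne mJ by (simp add: c_def)
  ultimately show ?thesis using that by blast
qed

lemma angle_le_of_quadrant_sums:
  fixes u a b :: "'i \<Rightarrow> complex"
  assumes "finite J" "J \<noteq> {}" and ne: "\<And>j. j \<in> J \<Longrightarrow> u j \<noteq> 0"
    and quad: "\<And>j. j \<in> J \<Longrightarrow> 0 \<le> Re (u j) \<and> 0 \<le> Im (u j)"
    and \<eta>: "0 \<le> \<eta>" "\<eta> < 1" and \<beta>: "0 \<le> \<beta>" "\<beta> < pi / 2"
    and a: "\<And>j. j \<in> J \<Longrightarrow> \<bar>1 - Re (a j)\<bar> \<le> \<eta> \<and> \<bar>Im (a j)\<bar> \<le> (1 - \<eta>) * sin \<beta>"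
    and b: "\<And>j. j \<in> J \<Longrightarrow> \<bar>1 - Re (b j)\<bar> \<le> \<eta> \<and> \<bar>Im (b j)\<bar> \<le> (1 - \<eta>) * sin \<beta>"
  shows "angle_le (2 * arctan \<eta> + 2 * \<beta>) (\<Sum>j\<in>J. a j * u j) (\<Sum>j\<in>J. b j * u j)"
proof -
  define X Y where "X = (\<Sum>j\<in>J. Re (u j))" and "Y = (\<Sum>j\<in>J. Im (u j))"
  have XY0: "0 \<le> X" "0 \<le> Y" unfolding X_def Y_def using quad by (auto intro: sum_nonneg)
  have XY: "X \<noteq> 0 \<or> Y \<noteq> 0"
  proof (rule ccontr)
    assume "\<not> (X \<noteq> 0 \<or> Y \<noteq> 0)"
    then have "\<forall>j\<in>J. Re (u j) = 0" "\<forall>j\<in>J. Im (u j) = 0"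
      unfolding X_def Y_def using quad assms(1) by (auto simp: sum_nonneg_eq_0_iff)
    then have "\<forall>j\<in>J. u j = 0" by (simp add: complex_eq_iff)
    then show False using ne assms(2) by blast
  qed
  define s where "s = sin \<beta>"
  have s0: "0 \<le> s" unfolding s_def using \<beta> by (intro sin_ge_zero) auto
  \<comment> \<open>Applied to each coordinate of the vectors separately; nonnegativity rules out cancellation.\<close>
  have box: "(1 - \<eta>) * sum f J \<le> (\<Sum>j\<in>J. Re (c j) * f j) \<and> (\<Sum>j\<in>J. Re (c j) * f j) \<le> (1 + \<eta>) * sum f J
     \<and> \<bar>\<Sum>j\<in>J. Im (c j) * f j\<bar> \<le> (1 - \<eta>) * s * sum f J"
    if c: "\<forall>j\<in>J. \<bar>1 - Re (c j)\<bar> \<le> \<eta> \<and> \<bar>Im (c j)\<bar> \<le> (1 - \<eta>) * s"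
      and f: "\<forall>j\<in>J. 0 \<le> f j" for c :: "'i \<Rightarrow> complex" and f :: "'i \<Rightarrow> real"
  proof (intro conjI)
    have c': "1 - \<eta> \<le> Re (c j)" "Re (c j) \<le> 1 + \<eta>" "\<bar>Im (c j)\<bar> \<le> (1 - \<eta>) * s"
      if "j \<in> J" for j using bspec[OF c that] by linarith+
    have f': "0 \<le> f j" if "j \<in> J" for j using bspec[OF f that] .
    show "(1 - \<eta>) * sum f J \<le> (\<Sum>j\<in>J. Re (c j) * f j)"
      unfolding sum_distrib_left by (intro sum_mono mult_right_mono c' f')
    show "(\<Sum>j\<in>J. Re (c j) * f j) \<le> (1 + \<eta>) * sum f J"
      unfolding sum_distrib_left by (intro sum_mono mult_right_mono c' f')
    have "\<bar>\<Sum>j\<in>J. Im (c j) * f j\<bar> \<le> (\<Sum>j\<in>J. \<bar>Im (c j) * f j\<bar>)" by (rule sum_abs)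
    also have "\<dots> \<le> (1 - \<eta>) * s * sum f J"
      unfolding sum_distrib_left
    proof (rule sum_mono)
      fix j assume j: "j \<in> J"
      show "\<bar>Im (c j) * f j\<bar> \<le> (1 - \<eta>) * s * f j"
        using mult_right_mono[OF c'(3)[OF j] f'[OF j]] f'[OF j] by (simp add: abs_mult)
    qed
    finally show "\<bar>\<Sum>j\<in>J. Im (c j) * f j\<bar> \<le> (1 - \<eta>) * s * sum f J" .
  qed
  \<comment> \<open>The sum with each coefficient \<open>c j\<close> replaced by its real part.\<close>
  define main where "main c = Complex (\<Sum>j\<in>J. Re (c j) * Re (u j)) (\<Sum>j\<in>J. Re (c j) * Im (u j))"
    for c :: "'i \<Rightarrow> complex"
  have mainbox: "(1 - \<eta>) * X \<le> Re (main c) \<and> Re (main c) \<le> (1 + \<eta>) * X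
      \<and> (1 - \<eta>) * Y \<le> Im (main c) \<and> Im (main c) \<le> (1 + \<eta>) * Y"
    if c: "\<forall>j\<in>J. \<bar>1 - Re (c j)\<bar> \<le> \<eta> \<and> \<bar>Im (c j)\<bar> \<le> (1 - \<eta>) * s" for c
    using box[OF c, where f = "\<lambda>j. Re (u j)"] box[OF c, where f = "\<lambda>j. Im (u j)"] quad
    by (simp add: main_def X_def Y_def)
  have real_part: "angle_le \<beta> (main c) (\<Sum>j\<in>J. c j * u j)"
    if c: "\<forall>j\<in>J. \<bar>1 - Re (c j)\<bar> \<le> \<eta> \<and> \<bar>Im (c j)\<bar> \<le> (1 - \<eta>) * s" for c
  proof -
    define E where "E = Complex (\<Sum>j\<in>J. Im (c j) * Re (u j)) (\<Sum>j\<in>J. Im (c j) * Im (u j))"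
    have split: "(\<Sum>j\<in>J. c j * u j) = main c + \<i> * E"
      by (rule complex_eqI) (simp_all add: main_def E_def sum_subtractf sum.distrib)
    have E: "\<bar>Re E\<bar> \<le> s * ((1 - \<eta>) * X)" "\<bar>Im E\<bar> \<le> s * ((1 - \<eta>) * Y)"
      using box[OF c, where f = "\<lambda>j. Re (u j)"] box[OF c, where f = "\<lambda>j. Im (u j)"] quad
      by (simp_all add: E_def X_def Y_def mult_ac)
    have "\<bar>Re E\<bar> \<le> s * Re (main c)" "\<bar>Im E\<bar> \<le> s * Im (main c)"
      using E mult_left_mono[OF _ s0, of "(1 - \<eta>) * X" "Re (main c)"]
        mult_left_mono[OF _ s0, of "(1 - \<eta>) * Y" "Im (main c)"] mainbox[OF c] by linarith+
    then have "(Re E)\<^sup>2 \<le> (s * Re (main c))\<^sup>2" "(Im E)\<^sup>2 \<le> (s * Im (main c))\<^sup>2"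
      by (intro abs_le_square_iff[THEN iffD1]; linarith)+
    then have "(cmod E)\<^sup>2 \<le> (s * cmod (main c))\<^sup>2"
      unfolding power_mult_distrib cmod_power2 by (simp add: algebra_simps)
    then have "cmod E \<le> s * cmod (main c)" by (rule power2_le_imp_le) (use s0 in simp)
    then have "cmod (\<i> * E) \<le> s * cmod (main c)" by (simp add: norm_mult)
    moreover have "main c \<noteq> 0"
    proof -
      have "0 < (1 - \<eta>) * X \<or> 0 < (1 - \<eta>) * Y" using \<eta> XY0 XY by auto
      then show ?thesis using mainbox[OF c] by auto
    qed
    ultimately show ?thesis
      unfolding split s_def using \<beta> by (intro angle_le_small_perturbation) auto
  qed
  have "angle_le (2 * arctan \<eta>) (main a) (main b)"
    using mainbox[of a] mainbox[of b] a b \<eta> XY0 XY unfolding s_def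
    by (intro angle_le_box[of \<eta> X Y]) auto
  moreover have "angle_le \<beta> (\<Sum>j\<in>J. a j * u j) (main a)"
    using real_part[of a] a unfolding s_def by (blast intro: angle_le_sym[of _ "main a"])
  moreover have "angle_le \<beta> (main b) (\<Sum>j\<in>J. b j * u j)"
    using real_part[of b] b unfolding s_def by blast
  ultimately have "angle_le (\<beta> + 2 * arctan \<eta> + \<beta>) (\<Sum>j\<in>J. a j * u j) (\<Sum>j\<in>J. b j * u j)"
    by (meson angle_le_trans)
  then show ?thesis by (simp add: algebra_simps)
qed

text \<open>
  The estimate behind the induction step. For \<open>2 arctan \<eta> + 2 \<beta> = \<pi> / (2 (d - 1))\<close>, a chain of \<open>d - 1\<close>
  conclusions is again a bound of \<open>\<pi> / 2\<close>, as the premise demands.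
\<close>

lemma angle_le_of_acute_sums:
  fixes u a b :: "'i \<Rightarrow> complex"
  assumes "finite J" "J \<noteq> {}"
    and acute: "\<And>i j. i \<in> J \<Longrightarrow> j \<in> J \<Longrightarrow> angle_le (pi / 2) (u i) (u j)"
    and \<eta>: "0 \<le> \<eta>" "\<eta> < 1" and \<beta>: "0 \<le> \<beta>" "\<beta> < pi / 2"
    and a: "\<And>j. j \<in> J \<Longrightarrow> \<bar>1 - Re (a j)\<bar> \<le> \<eta> \<and> \<bar>Im (a j)\<bar> \<le> (1 - \<eta>) * sin \<beta>"
    and b: "\<And>j. j \<in> J \<Longrightarrow> \<bar>1 - Re (b j)\<bar> \<le> \<eta> \<and> \<bar>Im (b j)\<bar> \<le> (1 - \<eta>) * sin \<beta>"
  shows "angle_le (2 * arctan \<eta> + 2 * \<beta>) (\<Sum>j\<in>J. a j * u j) (\<Sum>j\<in>J. b j * u j)"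
proof -
  have ne: "u j \<noteq> 0" if "j \<in> J" for j using acute[OF that that] angle_le_nonzero by blast
  obtain c where c: "c \<noteq> 0" "\<And>j. j \<in> J \<Longrightarrow> 0 \<le> Re (c * u j) \<and> 0 \<le> Im (c * u j)"
    using acute_family_in_rotated_quadrant[of J u] assms(1,2) ne angle_leD_right_angle[OF acute]
    by blast
  have "angle_le (2 * arctan \<eta> + 2 * \<beta>) (\<Sum>j\<in>J. a j * (c * u j)) (\<Sum>j\<in>J. b j * (c * u j))"
    using assms c ne by (intro angle_le_of_quadrant_sums) auto
  then have "angle_le (2 * arctan \<eta> + 2 * \<beta>) (c * (\<Sum>j\<in>J. a j * u j)) (c * (\<Sum>j\<in>J. b j * u j))"
    by (simp add: sum_distrib_left mult_ac)
  then show ?thesis using c(1) angle_le_mult_cancel by blast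
qed

section \<open>Permanents as sums over perfect matchings\<close>

text \<open>
  Perfect matchings of the complete \<open>d\<close>-partite hypergraph with parts \<open>S 0, \<dots>, S (d - 1)\<close>; an edge
  is the list of its vertices.
\<close>

definition matchings :: "nat \<Rightarrow> (nat \<Rightarrow> 'a set) \<Rightarrow> 'a list set set" where
  "matchings d S =
     {M. (\<forall>e\<in>M. length e = d) \<and> (\<forall>l<d. bij_betw (\<lambda>e. e ! l) M (S l))}"

definition matching_sum :: "nat \<Rightarrow> ('a list \<Rightarrow> 'b::comm_ring_1) \<Rightarrow> (nat \<Rightarrow> 'a set) \<Rightarrow> 'b" where
  "matching_sum d Z S = (\<Sum>M\<in>matchings d S. \<Prod>e\<in>M. Z e)"

lemma matching_sum_cong:
  assumes "\<And>l. l < d \<Longrightarrow> S l = T l"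
  shows "matching_sum d Z S = matching_sum d Z T"
  using assms unfolding matching_sum_def matchings_def by (intro sum.cong) auto

definition transversals :: "nat \<Rightarrow> (nat \<Rightarrow> 'a set) \<Rightarrow> 'a list set" where
  "transversals d S = {e. length e = d \<and> (\<forall>l<d. e ! l \<in> S l)}"

lemma finite_transversals:
  assumes "\<And>l. l < d \<Longrightarrow> finite (S l)"
  shows "finite (transversals d S)"
proof (rule finite_subset)
  show "transversals d S \<subseteq> {e. set e \<subseteq> (\<Union>l<d. S l) \<and> length e = d}"
    unfolding transversals_def by (force simp: in_set_conv_nth)
  show "finite {e. set e \<subseteq> (\<Union>l<d. S l) \<and> length e = d}"
    using assms by (intro finite_lists_length_eq) auto
qed

lemma matching_subset_transversals: "M \<in> matchings d S \<Longrightarrow> M \<subseteq> transversals d S"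
  unfolding matchings_def transversals_def bij_betw_def by auto

text \<open>
  Laplace expansion along the slice of \<open>x\<close> in direction \<open>k\<close>: every perfect matching has exactly one
  edge through \<open>x\<close>, and removing it leaves a perfect matching of the remaining vertices.
\<close>

lemma matching_sum_expand:
  assumes fin: "\<And>l. l < d \<Longrightarrow> finite (S l)" and k: "k < d" and x: "x \<in> S k"
  shows "matching_sum d Z S =
    (\<Sum>e \<in> {e \<in> transversals d S. e ! k = x}. Z e * matching_sum d Z (\<lambda>l. S l - {e ! l}))"
proof -
  define E where "E = {e \<in> transversals d S. e ! k = x}"
  define N where "N e = matchings d (\<lambda>l. S l - {e ! l})" for e
  have finE: "finite E" unfolding E_def using finite_transversals[of d S] fin by auto
  have finN: "finite (N e)" for e
  proof (rule finite_subset)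
    show "N e \<subseteq> Pow (transversals d (\<lambda>l. S l - {e ! l}))"
      unfolding N_def using matching_subset_transversals by auto
    show "finite (Pow (transversals d (\<lambda>l. S l - {e ! l})))"
      using fin by (simp add: finite_transversals)
  qed
  have notk: "f ! k \<noteq> x" if "e \<in> E" "M \<in> N e" "f \<in> M" for e M f
    using that k matching_subset_transversals[of M] unfolding N_def E_def transversals_def by force
  have notin: "e \<notin> M" if "e \<in> E" "M \<in> N e" for e M
    using notk[OF that] that(1) unfolding E_def by auto
  have finM: "finite M" if "M \<in> N e" for e M
    using that fin matching_subset_transversals[of M] unfolding N_def
    by (meson finite_Diff finite_subset finite_transversals)
  have bij: "bij_betw (\<lambda>(e, M). insert e M) (SIGMA e:E. N e) (matchings d S)"
    unfolding bij_betw_def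
  proof
    show "inj_on (\<lambda>(e, M). insert e M) (SIGMA e:E. N e)"
    proof (rule inj_onI, clarsimp)
      fix e M e' M' assume h: "e \<in> E" "M \<in> N e" "e' \<in> E" "M' \<in> N e'" "insert e M = insert e' M'"
      have "e = e'" using h notk[OF h(3,4), of e] unfolding E_def by auto
      then show "e = e' \<and> M = M'" using h notin by (metis insert_ident)
    qed
    show "(\<lambda>(e, M). insert e M) ` (SIGMA e:E. N e) = matchings d S"
    proof (intro equalityI subsetI)
      fix M0 assume "M0 \<in> (\<lambda>(e, M). insert e M) ` (SIGMA e:E. N e)"
      then obtain e M where eM: "e \<in> E" "M \<in> N e" "M0 = insert e M" by auto
      have "bij_betw (\<lambda>e. e ! l) (insert e M) (S l)" if l: "l < d" for l
      proof -
        have "bij_betw (\<lambda>e. e ! l) M (S l - {e ! l})"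
          using eM(2) l unfolding N_def matchings_def by auto
        then have "bij_betw (\<lambda>e. e ! l) (insert e M) (insert (e ! l) (S l - {e ! l}))"
          using notin[OF eM(1,2)] unfolding bij_betw_def by auto
        moreover have "e ! l \<in> S l" using eM(1) l unfolding E_def transversals_def by auto
        ultimately show ?thesis by (simp add: insert_absorb)
      qed
      then show "M0 \<in> matchings d S"
        using eM unfolding matchings_def N_def E_def transversals_def by auto
    next
      fix M0 assume M0: "M0 \<in> matchings d S"
      then have "bij_betw (\<lambda>e. e ! k) M0 (S k)" using k unfolding matchings_def by auto
      then have "x \<in> (\<lambda>e. e ! k) ` M0" using x by (simp add: bij_betw_imp_surj_on)
      then obtain e where e: "e \<in> M0" "e ! k = x" by auto
      have eE: "e \<in> E" using e matching_subset_transversals[OF M0] unfolding E_def by auto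
      have "bij_betw (\<lambda>e. e ! l) (M0 - {e}) (S l - {e ! l})" if l: "l < d" for l
      proof -
        have "bij_betw (\<lambda>e. e ! l) M0 (S l)" using M0 l unfolding matchings_def by auto
        then show ?thesis using e(1) unfolding bij_betw_def inj_on_def by auto
      qed
      then have "M0 - {e} \<in> N e" using M0 unfolding N_def matchings_def by auto
      then show "M0 \<in> (\<lambda>(e, M). insert e M) ` (SIGMA e:E. N e)"
        using eE e(1) by (intro image_eqI[of _ _ "(e, M0 - {e})"]) auto
    qed
  qed
  have "matching_sum d Z S = (\<Sum>p\<in>(SIGMA e:E. N e). \<Prod>f\<in>(case p of (e, M) \<Rightarrow> insert e M). Z f)"
    unfolding matching_sum_def by (rule sum.reindex_bij_betw[OF bij, symmetric])
  also have "\<dots> = (\<Sum>(e, M)\<in>(SIGMA e:E. N e). Z e * (\<Prod>f\<in>M. Z f))"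
    using notin finM by (intro sum.cong) auto
  also have "\<dots> = (\<Sum>e\<in>E. \<Sum>M\<in>N e. Z e * (\<Prod>f\<in>M. Z f))"
    using finE finN by (subst sum.Sigma) auto
  finally show ?thesis
    unfolding matching_sum_def N_def E_def by (simp add: sum_distrib_left)
qed

lemma matching_sum_empty:
  assumes "0 < d" "\<And>l. l < d \<Longrightarrow> S l = {}"
  shows "matching_sum d Z S = 1"
proof -
  have "matchings d S = {{}}"
    using assms unfolding matchings_def by (auto simp: bij_betw_def)
  then show ?thesis by (simp add: matching_sum_def)
qed

text \<open>
  The edges \<open>(i, \<sigma>\<^sub>2(i), \<dots>, \<sigma>\<^sub>d(i))\<close> form a perfect matching. Conversely, the edges of a perfect matching
  can be labelled by their first vertices, and their other vertices then define the permutations.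
\<close>

lemma PER_eq_matching_sum:
  assumes d: "1 \<le> d"
  shows "PER d n Z = matching_sum d Z (\<lambda>_. {1..n})"
proof -
  define row where "row \<sigma> i = i # map (\<lambda>k. \<sigma> k i) [2..<Suc d]" for \<sigma> :: "nat \<Rightarrow> nat \<Rightarrow> nat" and i
  define P where "P = ({2..d} \<rightarrow>\<^sub>E {p. p permutes {1..n}})"
  have len: "length (row \<sigma> i) = d" for \<sigma> i using d by (simp add: row_def del: upt_Suc)
  have row0: "row \<sigma> i ! 0 = i" for \<sigma> i by (simp add: row_def)
  have rowS: "row \<sigma> i ! l = \<sigma> (Suc l) i" if "0 < l" "l < d" for \<sigma> i l
    using that by (cases l) (simp_all add: row_def del: upt_Suc)
  have inj: "inj_on (row \<sigma>) A" for \<sigma> A by (rule inj_onI) (metis row0)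
  have perm: "\<sigma> k permutes {1..n}" if "\<sigma> \<in> P" "2 \<le> k" "k \<le> d" for \<sigma> k
    using that unfolding P_def by (auto simp: PiE_iff)
  have bij: "bij_betw (\<lambda>\<sigma>. row \<sigma> ` {1..n}) P (matchings d (\<lambda>_. {1..n}))"
    unfolding bij_betw_def
  proof
    show "inj_on (\<lambda>\<sigma>. row \<sigma> ` {1..n}) P"
    proof (rule inj_onI)
      fix \<sigma> \<tau> assume h: "\<sigma> \<in> P" "\<tau> \<in> P" "row \<sigma> ` {1..n} = row \<tau> ` {1..n}"
      have eq: "row \<sigma> i = row \<tau> i" if "i \<in> {1..n}" for i
      proof -
        have "row \<sigma> i \<in> row \<tau> ` {1..n}" using that unfolding h(3)[symmetric] by (rule imageI)
        then obtain j where "row \<sigma> i = row \<tau> j" by (rule imageE)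
        then show ?thesis by (metis row0)
      qed
      show "\<sigma> = \<tau>"
      proof (rule PiE_ext)
        show "\<sigma> \<in> {2..d} \<rightarrow>\<^sub>E {p. p permutes {1..n}}" "\<tau> \<in> {2..d} \<rightarrow>\<^sub>E {p. p permutes {1..n}}"
          using h unfolding P_def by auto
        fix k assume k: "k \<in> {2..d}"
        show "\<sigma> k = \<tau> k"
        proof
          fix i
          show "\<sigma> k i = \<tau> k i"
          proof (cases "i \<in> {1..n}")
            case True
            have l: "0 < k - 1" "k - 1 < d" "Suc (k - 1) = k" using k by auto
            show ?thesis using eq[OF True] rowS[OF l(1,2)] unfolding l(3) by metis
          next
            case False
            then show ?thesis using perm[OF h(1), of k] perm[OF h(2), of k] k
              by (simp add: permutes_not_in)
          qed
        qed
      qed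
    qed
    show "(\<lambda>\<sigma>. row \<sigma> ` {1..n}) ` P = matchings d (\<lambda>_. {1..n})"
    proof (intro equalityI subsetI)
      fix M assume "M \<in> (\<lambda>\<sigma>. row \<sigma> ` {1..n}) ` P"
      then obtain \<sigma> where \<sigma>: "\<sigma> \<in> P" "M = row \<sigma> ` {1..n}" by blast
      have "bij_betw (\<lambda>e. e ! l) M {1..n}" if l: "l < d" for l
      proof -
        have "bij_betw (\<lambda>i. row \<sigma> i ! l) {1..n} {1..n}"
        proof (cases "l = 0")
          case True
          then show ?thesis by (simp add: row0 bij_betw_def)
        next
          case False
          then show ?thesis using l rowS perm[OF \<sigma>(1), of "Suc l"] permutes_imp_bij by auto
        qed
        moreover have "bij_betw (row \<sigma>) {1..n} M" using inj \<sigma>(2) by (simp add: bij_betw_def)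
        ultimately show ?thesis
          using bij_betw_comp_iff[of "row \<sigma>" "{1..n}" M "\<lambda>e. e ! l" "{1..n}"] by (simp add: comp_def)
      qed
      then show "M \<in> matchings d (\<lambda>_. {1..n})" using \<sigma>(2) len by (auto simp: matchings_def)
    next
      fix M assume M: "M \<in> matchings d (\<lambda>_. {1..n})"
      have bM: "bij_betw (\<lambda>e. e ! l) M {1..n}" if "l < d" for l
        using M that unfolding matchings_def by auto
      have lM: "length e = d" if "e \<in> M" for e using M that unfolding matchings_def by auto
      have b0: "bij_betw (\<lambda>e. e ! 0) M {1..n}" using bM d by auto
      define g where "g = inv_into M (\<lambda>e. e ! 0)"
      have g: "bij_betw g {1..n} M" unfolding g_def by (rule bij_betw_inv_into[OF b0])
      have g0: "g i ! 0 = i" if "i \<in> {1..n}" for i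
        unfolding g_def using bij_betw_inv_into_right[OF b0 that] .
      define \<sigma> where "\<sigma> = (\<lambda>k\<in>{2..d}. \<lambda>i. if i \<in> {1..n} then g i ! (k - 1) else i)"
      have "(\<lambda>i. if i \<in> {1..n} then g i ! (k - 1) else i) permutes {1..n}" if k: "k \<in> {2..d}" for k
      proof (rule bij_imp_permutes)
        have "bij_betw ((\<lambda>e. e ! (k - 1)) \<circ> g) {1..n} {1..n}"
          using g bM[of "k - 1"] k by (intro bij_betw_trans) auto
        then show "bij_betw (\<lambda>i. if i \<in> {1..n} then g i ! (k - 1) else i) {1..n} {1..n}"
          by (rule bij_betw_cong[THEN iffD1, rotated]) auto
      qed auto
      then have "\<sigma> \<in> P" unfolding P_def \<sigma>_def by auto
      moreover have "row \<sigma> i = g i" if i: "i \<in> {1..n}" for i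
      proof (rule nth_equalityI)
        show lr: "length (row \<sigma> i) = length (g i)"
          using len lM g i by (metis bij_betwE)
        fix l assume l: "l < length (row \<sigma> i)"
        show "row \<sigma> i ! l = g i ! l"
        proof (cases "l = 0")
          case True
          then show ?thesis using row0 g0[OF i] by simp
        next
          case False
          then show ?thesis using rowS[of l \<sigma> i] l len i by (simp add: \<sigma>_def)
        qed
      qed
      then have "row \<sigma> ` {1..n} = M" using g unfolding bij_betw_def by auto
      ultimately show "M \<in> (\<lambda>\<sigma>. row \<sigma> ` {1..n}) ` P" by blast
    qed
  qed
  have "PER d n Z = (\<Sum>\<sigma>\<in>P. \<Prod>i\<in>{1..n}. Z (row \<sigma> i))"
    unfolding PER_def P_def row_def ..
  also have "\<dots> = (\<Sum>\<sigma>\<in>P. \<Prod>e\<in>row \<sigma> ` {1..n}. Z e)"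
    using inj by (simp add: prod.reindex)
  also have "\<dots> = matching_sum d Z (\<lambda>_. {1..n})"
    unfolding matching_sum_def by (rule sum.reindex_bij_betw[OF bij])
  finally show ?thesis .
qed

section \<open>The induction on the size\<close>

text \<open>
  The size \<open>n\<close> is the common cardinality of the index sets, which range over all subsets of \<open>U\<close>, so
  that the induction hypothesis covers every minor. The case \<open>y = x\<close> is included on
  purpose: it bounds the angle of the sum with itself, which says that the sum is not zero.
\<close>

lemma matching_sum_exchange:
  fixes Z :: "'a list \<Rightarrow> complex"
  assumes fin: "finite U" and d: "2 \<le> d"
    and \<eta>: "0 \<le> \<eta>" "\<eta> < 1" and \<beta>: "0 \<le> \<beta>" "\<beta> < pi / 2"
    and \<alpha>: "\<alpha> = 2 * arctan \<eta> + 2 * \<beta>" "(real d - 1) * \<alpha> = pi / 2"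
    and Z: "\<And>e. length e = d \<Longrightarrow> set e \<subseteq> U \<Longrightarrow> \<bar>1 - Re (Z e)\<bar> \<le> \<eta> \<and> \<bar>Im (Z e)\<bar> \<le> (1 - \<eta>) * sin \<beta>"
    and S: "\<And>l. l < d \<Longrightarrow> S l \<subseteq> U \<and> card (S l) = n"
  shows "matching_sum d Z S \<noteq> 0 \<and>
    (\<forall>k<d. \<forall>x\<in>S k. \<forall>y\<in>U. y \<notin> S k - {x} \<longrightarrow>
      angle_le \<alpha> (matching_sum d Z S) (matching_sum d Z (S(k := insert y (S k - {x})))))"
  using S
proof (induction n arbitrary: S)
  case 0
  then have "\<And>l. l < d \<Longrightarrow> S l = {}" using fin by (metis card_0_eq finite_subset)
  then show ?case using d by (simp add: matching_sum_empty)
next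
  case (Suc n)
  have finS: "finite (S l)" if "l < d" for l using Suc.prems that fin finite_subset by blast
  have swap: "angle_le \<alpha> (matching_sum d Z S) (matching_sum d Z (S(k := insert y (S k - {x}))))"
    if k: "k < d" and x: "x \<in> S k" and y: "y \<in> U" "y \<notin> S k - {x}" for k x y
  proof -
    define T where "T = S(k := insert y (S k - {x}))"
    define J where "J = {e \<in> transversals d S. e ! k = x}"
    define minor where "minor e = (\<lambda>l. S l - {e ! l})" for e
    define u where "u e = matching_sum d Z (minor e)" for e
    have finJ: "finite J" unfolding J_def using finite_transversals[of d S] finS by auto
    have Jne: "J \<noteq> {}"
    proof -
      have "\<exists>z. z \<in> S l" if "l < d" for l using Suc.prems[OF that] by (metis card.empty ex_in_conv nat.distinct(1))
      then have "map (\<lambda>l. if l = k then x else SOME z. z \<in> S l) [0..<d] \<in> J"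
        unfolding J_def transversals_def using k x by (auto intro: someI_ex)
      then show ?thesis by blast
    qed
    have lenJ: "length e = d" if "e \<in> J" for e using that by (simp add: J_def transversals_def)
    have SJ: "e ! l \<in> S l" if "e \<in> J" "l < d" for e l using that by (simp add: J_def transversals_def)
    have kJ: "e ! k = x" if "e \<in> J" for e using that by (simp add: J_def)
    have \<alpha>0: "0 \<le> \<alpha>" using \<alpha> \<eta> \<beta> by auto
    have acute: "angle_le (pi / 2) (u e) (u f)" if e: "e \<in> J" and f: "f \<in> J" for e f
    proof -
      \<comment> \<open>Pass from the minor of \<open>e\<close> to that of \<open>f\<close> one direction at a time: \<open>mix D\<close> has already been
          switched in the directions in \<open>D\<close>. Direction \<open>k\<close> needs no switch, since \<open>x\<close> is removed there in both.\<close>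
      define mix where "mix D = (\<lambda>l. if l \<in> D then S l - {f ! l} else S l - {e ! l})" for D
      have mixcard: "mix D l \<subseteq> U \<and> card (mix D l) = n" if "l < d" for D l
        using Suc.prems[OF that] finS[OF that] SJ[OF e that] SJ[OF f that] by (auto simp: mix_def)
      have step: "angle_le (real (card D) * \<alpha>) (u e) (matching_sum d Z (mix D))"
        if "finite D" "D \<subseteq> {..<d} - {k}" for D
        using that
      proof (induction D rule: finite_induct)
        case empty
        have "mix {} = minor e" by (auto simp: mix_def minor_def)
        moreover have "matching_sum d Z (mix {}) \<noteq> 0" using Suc.IH mixcard by blast
        ultimately show ?case by (simp add: u_def angle_le_refl)
      next
        case (insert l D)
        have l: "l < d" using insert by auto
        have "angle_le \<alpha> (matching_sum d Z (mix D)) (matching_sum d Z (mix (insert l D)))"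
        proof (cases "e ! l = f ! l")
          case True
          then have "mix (insert l D) = mix D" by (simp add: mix_def fun_eq_iff)
          moreover have "matching_sum d Z (mix D) \<noteq> 0" using Suc.IH mixcard by blast
          ultimately show ?thesis using \<alpha>0 by (simp add: angle_le_refl)
        next
          case False
          \<comment> \<open>Removing \<open>f ! l\<close> instead of \<open>e ! l\<close> puts \<open>e ! l\<close> back and takes \<open>f ! l\<close> out.\<close>
          have "mix (insert l D) = (mix D)(l := insert (e ! l) (mix D l - {f ! l}))"
            using False insert(2) SJ[OF e l] SJ[OF f l] by (auto simp: mix_def fun_eq_iff)
          moreover have "f ! l \<in> mix D l" "e ! l \<in> U" "e ! l \<notin> mix D l - {f ! l}"
            using False insert(2) SJ[OF e l] SJ[OF f l] Suc.prems[OF l] by (auto simp: mix_def)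
          ultimately show ?thesis using Suc.IH[of "mix D", OF mixcard] l by metis
        qed
        then have "angle_le (real (card D) * \<alpha> + \<alpha>) (u e) (matching_sum d Z (mix (insert l D)))"
          using insert by (blast intro: angle_le_trans)
        then show ?case using insert by (simp add: algebra_simps)
      qed
      have "matching_sum d Z (mix ({..<d} - {k})) = u f"
        unfolding u_def using kJ[OF e] kJ[OF f] by (intro matching_sum_cong) (auto simp: mix_def minor_def)
      moreover have "real (card ({..<d} - {k})) * \<alpha> = pi / 2"
        using k d \<alpha>(2) by simp
      ultimately show ?thesis using step[of "{..<d} - {k}"]
        by (metis finite_Diff finite_lessThan order_refl)
    qed
    have sumS: "matching_sum d Z S = (\<Sum>e\<in>J. Z e * u e)"
      unfolding J_def u_def minor_def using finS k x by (intro matching_sum_expand) auto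
    have finT: "finite (T l)" if "l < d" for l using finS[OF that] finS[OF k] by (simp add: T_def)
    \<comment> \<open>Moving an edge from \<open>x\<close> to \<open>y\<close> leaves its minor unchanged, so both expansions share their minors.\<close>
    have bij: "bij_betw (\<lambda>e. e[k := y]) J {e \<in> transversals d T. e ! k = y}"
    proof (rule bij_betw_byWitness[where f' = "\<lambda>e. e[k := x]"])
      show "\<forall>e\<in>J. e[k := y, k := x] = e"
        using kJ by (metis list_update_id list_update_overwrite)
      show "\<forall>e\<in>{e \<in> transversals d T. e ! k = y}. e[k := x, k := y] = e"
        by (metis (mono_tags, lifting) list_update_id list_update_overwrite mem_Collect_eq)
      show "(\<lambda>e. e[k := y]) ` J \<subseteq> {e \<in> transversals d T. e ! k = y}"
        using k by (auto simp: J_def T_def transversals_def nth_list_update)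
      show "(\<lambda>e. e[k := x]) ` {e \<in> transversals d T. e ! k = y} \<subseteq> J"
        using k x by (force simp: J_def T_def transversals_def nth_list_update)
    qed
    have "matching_sum d Z T = (\<Sum>e\<in>{e \<in> transversals d T. e ! k = y}. Z e * matching_sum d Z (\<lambda>l. T l - {e ! l}))"
      using finT k by (intro matching_sum_expand) (auto simp: T_def)
    also have "\<dots> = (\<Sum>e\<in>J. Z (e[k := y]) * matching_sum d Z (\<lambda>l. T l - {e[k := y] ! l}))"
      by (rule sum.reindex_bij_betw[OF bij, symmetric])
    also have "\<dots> = (\<Sum>e\<in>J. Z (e[k := y]) * u e)"
    proof (intro sum.cong refl arg_cong2[of _ _ _ _ "(*)"])
      fix e assume e: "e \<in> J"
      show "matching_sum d Z (\<lambda>l. T l - {e[k := y] ! l}) = u e"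
        unfolding u_def using y kJ[OF e] lenJ[OF e] k
        by (intro matching_sum_cong) (auto simp: T_def minor_def nth_list_update)
    qed
    finally have sumT: "matching_sum d Z T = (\<Sum>e\<in>J. Z (e[k := y]) * u e)" .
    have setJ: "set e \<subseteq> U" if "e \<in> J" for e
      using SJ[OF that] Suc.prems lenJ[OF that] by (fastforce simp: in_set_conv_nth)
    have setJ': "set (e[k := y]) \<subseteq> U" if "e \<in> J" for e
      using setJ[OF that] set_update_subset_insert[of e k y] y by blast
    have "angle_le (2 * arctan \<eta> + 2 * \<beta>) (\<Sum>e\<in>J. Z e * u e) (\<Sum>e\<in>J. Z (e[k := y]) * u e)"
      using finJ Jne acute \<eta> \<beta> Z setJ setJ' lenJ by (intro angle_le_of_acute_sums) auto
    then show ?thesis using sumS sumT \<alpha>(1) unfolding T_def by simp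
  qed
  moreover have "matching_sum d Z S \<noteq> 0"
  proof -
    have "0 < d" using d by simp
    then obtain x where x: "x \<in> S 0" using Suc.prems[of 0] by (metis card.empty ex_in_conv nat.distinct(1))
    then have "x \<in> U" using Suc.prems[of 0] \<open>0 < d\<close> by auto
    then show ?thesis using swap[OF \<open>0 < d\<close> x, of x] angle_le_nonzero by blast
  qed
  ultimately show ?case by blast
qed

theorem theorem3p5:
  fixes d n :: nat and \<eta>\<^sub>d \<eta> \<tau> :: real and Z :: "nat list \<Rightarrow> complex"
  assumes "d \<ge> 2"
    and "\<eta>\<^sub>d = tan (pi / (4 * (real d - 1)))"
    and "0 \<le> \<eta>" and "\<eta> < \<eta>\<^sub>d"
    and "\<tau> = (1 - \<eta>) * sin (pi / (4 * (real d - 1)) - arctan \<eta>)"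
    and "n \<ge> 1"
    and "\<And>is. is \<in> tensor_indices d n \<Longrightarrow> \<bar>1 - Re (Z is)\<bar> \<le> \<eta> \<and> \<bar>Im (Z is)\<bar> \<le> \<tau>"
  shows "\<tau> > 0 \<and> PER d n Z \<noteq> 0"
proof -
  define \<gamma> where "\<gamma> = pi / (4 * (real d - 1))"
  define \<beta> where "\<beta> = \<gamma> - arctan \<eta>"
  have d1: "1 \<le> real d - 1" using assms(1) by linarith
  have \<gamma>0: "0 < \<gamma>" using d1 by (simp add: \<gamma>_def)
  have "pi / (4 * (real d - 1)) \<le> pi / 4" using d1 by (intro divide_left_mono) auto
  then have \<gamma>4: "\<gamma> \<le> pi / 4" by (simp add: \<gamma>_def)
  have "tan \<gamma> \<le> tan (pi / 4)" using \<gamma>0 \<gamma>4 by (subst tan_mono_le_eq) auto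
  then have \<eta>1: "\<eta> < 1" using assms(2,4) by (simp add: \<gamma>_def tan_45)
  have "arctan \<eta> < arctan (tan \<gamma>)" using assms(2,4) by (simp add: \<gamma>_def arctan_less_iff)
  also have "arctan (tan \<gamma>) = \<gamma>" using \<gamma>0 \<gamma>4 by (intro arctan_tan) auto
  finally have \<beta>0: "0 < \<beta>" by (simp add: \<beta>_def)
  have "0 \<le> arctan \<eta>" using assms(3) by simp
  then have \<beta>2: "\<beta> < pi / 2" using \<gamma>4 pi_gt_zero unfolding \<beta>_def by linarith
  have \<tau>: "\<tau> = (1 - \<eta>) * sin \<beta>" using assms(5) by (simp add: \<beta>_def \<gamma>_def)
  have "0 < sin \<beta>" using \<beta>0 \<beta>2 by (intro sin_gt_zero) auto
  then have "\<tau> > 0" using \<eta>1 by (simp add: \<tau>)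
  moreover have "matching_sum d Z (\<lambda>_. {1..n}) \<noteq> 0"
  proof -
    have "(real d - 1) * (2 * \<gamma>) = pi / 2" using d1 by (simp add: \<gamma>_def field_simps)
    moreover have "2 * \<gamma> = 2 * arctan \<eta> + 2 * \<beta>" by (simp add: \<beta>_def)
    ultimately show ?thesis
      using matching_sum_exchange[of "{1..n}" d \<eta> \<beta> "2 * \<gamma>" Z "\<lambda>_. {1..n}" n]
        assms(1,3,7) \<eta>1 \<beta>0 \<beta>2 by (simp add: \<tau> tensor_indices_def)
  qed
  ultimately show ?thesis using PER_eq_matching_sum[of d n Z] assms(1) by simp
qed

end
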